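(* Assume (RHS.1), (RHS.2a), (BC.1), (BC.2), (OBS.1), and that there is $\alpha\in(0,1]$ with $f\in C^{0,\alpha}(\overline\Omega)$, $g\in C^{0,\alpha}(\partial\Omega)$, $\chi\in C^{0,\alpha}(\overline\Omega)$, and such that the viscosity solution $u$ of the obstacle problem satisfies $u\in C^{0,\alpha}(\overline\Omega)$. Let $u_{\mathfrak h}$ be the solution of the discrete obstacle problem. If $\mathfrak h=(h,\varepsilon,\theta)$ is sufficiently small and $\big((\varepsilon\theta)^\alpha+h^\alpha\big)/\varepsilon^2$ is sufficiently small, then $$\|u-u_{\mathfrak h}\|_{L^\infty(\Omega_h)}\le C\Big(\varepsilon^\alpha+\frac{\theta^\alpha}{\varepsilon^{2-\alpha}}+\frac{h^\alpha}{\varepsilon^2}\Big),$$ where $C$ depends on $d$, $\Omega$, the shape regularity of the meshes, $\min_{\overline\Omega}|f|$, and the $C^{0,\alpha}$ norms of $f$, $g$, $\chi$ and $u$.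
   Context: Setting: $\Omega\subset\mathbb R^d$ ($d\ge1$) is a bounded domain with continuous boundary. For $r>0$, $\Omega^{(r)}=\{x\in\Omega:\operatorname{dist}(x,\partial\Omega)>r\}$. $\{\mathcal T_h\}_{h>0}$ is a quasiuniform family of meshes of closed simplices, $h=\max_T\operatorname{diam}T$, $\Omega_h$ the interior of the union of the simplices, with $\Omega^{(h)}\subset\Omega_h\subset\Omega$; $\mathcal N_h$ the set of vertices. $\mathbb V_h$: continuous piecewise linear functions on $\mathcal T_h$; $\mathcal I_h$: Lagrange interpolant. Parameters $\mathfrak h=(h,\varepsilon,\theta)$, $\varepsilon\in[h,\operatorname{diam}\Omega]$, $0<\theta\le1$. $\mathcal N_h^I=\mathcal N_h\cap\Omega^{(2\varepsilon)}$, $\mathcal N_h^b=\mathcal N_h\setminus\mathcal N_h^I$. $\mathbb S_\theta$: finite symmetric subset of the unit sphere $\mathbb S$ such that each $v\in\mathbb S$ has $v_\theta\in\mathbb S_\theta$ with $|v-v_\theta|\le\theta$. For $z\in\mathcal N_h^I$, $\mathcal N_{\mathfrak h}(z)=\{z\}\cup\{z+\varepsilon v_\theta:v_\theta\in\mathbb S_\theta\}$, $-\Delta^\diamond_{\infty,\mathfrak h}w(z)=\varepsilon^{-2}\big(2w(z)-\max_{x\in\mathcal N_{\mathfrak h}(z)}\mathcal I_hw(x)-\min_{x\in\mathcal N_{\mathfrak h}(z)}\mathcal I_hw(x)\big)$. Assumptions: (RHS.1) $f\in C(\Omega)\cap L^\infty(\Omega)$. (RHS.2a) $\sup_\Omega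 f<0$ or $\inf_\Omega f>0$. (BC.1) $g\in C(\partial\Omega)$. (BC.2) for every $\varepsilon>0$ a function $\tilde g_\varepsilon\in C(\overline\Omega)$ is given such that, if $g\in C^{0,\alpha}(\partial\Omega)$ for some $\alpha\in[0,1]$, then $\tilde g_\varepsilon\in C^{0,\alpha}(\overline\Omega)$ and $\|g-\tilde g_\varepsilon\|_{L^\infty(\partial\Omega)}\le C\varepsilon^\alpha$. (OBS.1) $\chi\in C(\overline\Omega)$, $\chi<g$ on $\partial\Omega$. Discrete obstacle problem: find $u_{\mathfrak h}\in\mathbb V_h$ with $\min\{-\Delta^\diamond_{\infty,\mathfrak h}u_{\mathfrak h}(z)-f(z),\,u_{\mathfrak h}(z)-\chi(z)\}=0$ for $z\in\mathcal N_h^I$ and $u_{\mathfrak h}(z)=\tilde g_\varepsilon(z)$ for $z\in\mathcal N_h^b$. Continuous obstacle problem: with $\Delta^\diamond_\infty\varphi=|D\varphi|^{-2}D\varphi^\intercal D^2\varphi D\varphi$ where $D\varphi\ne0$ and $\Delta^\pm_\infty\varphi(x)$ equal to this if $D\varphi(x)\ne0$ and to $\lambda_{\max}$, resp. $\lambda_{\min}$, of $D^2\varphi(x)$ otherwise, the viscosity solution is $u\in C(\overline\Omega)$ with $u=g$ on $\partial\Omega$ such that for all $x_0\in\Omega$, $\varphi\in C^2$: $u-\varphi$ local max at $x_0$ implies $\min\{-\Delta^+_\infty\varphi(x_0)-f(x_0),u(x_0)-\chi(x_0)\}\le0$; $u-\varphi$ local min at $x_0$ implies $\min\{-\Delta^-_\infty\varphi(x_0)-f(x_0),u(x_0)-\chi(x_0)\}\ge0$.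 It exists and is unique.
   Formalization: In (BC.2) the C^{0,α} norms of the extensions g̃_ε are assumed bounded uniformly in ε, and C may depend on that bound and on the (BC.2) constant; without it, g=0 with g̃_ε=min(1,dist(x,∂Ω)/ε) violates the estimate. *)

theory Defs
  imports "HOL-Analysis.Analysis"
begin

definition inner_region :: "'a::euclidean_space set \<Rightarrow> real \<Rightarrow> 'a set" where
  "inner_region \<Omega> r = {x \<in> \<Omega>. infdist x (frontier \<Omega>) > r}"

text \<open>Continuous boundary: near each boundary point, Omega is (in suitable orthonormal
  coordinates, the last direction being the unit vector e) the strict epigraph of a continuous
  function of the remaining coordinates (the projection onto the hyperplane orthogonal to e).\<close>
definition continuous_boundary :: "'a::euclidean_space set \<Rightarrow> bool" where
  "continuous_boundary \<Omega> \<longleftrightarrow>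
     (\<forall>x0\<in>frontier \<Omega>. \<exists>r>0. \<exists>e::'a. \<exists>\<gamma>::'a \<Rightarrow> real.
        norm e = 1 \<and> continuous_on {y. e \<bullet> y = 0} \<gamma> \<and>
        \<Omega> \<inter> ball x0 r = {x \<in> ball x0 r. e \<bullet> x > \<gamma> (x - (e \<bullet> x) *\<^sub>R e)})"

definition holder_bounded :: "'a::metric_space set \<Rightarrow> real \<Rightarrow> real \<Rightarrow> ('a \<Rightarrow> real) \<Rightarrow> bool" where
  "holder_bounded S \<alpha> M u \<longleftrightarrow>
     (\<forall>x\<in>S. \<bar>u x\<bar> \<le> M) \<and> (\<forall>x\<in>S. \<forall>y\<in>S. \<bar>u x - u y\<bar> \<le> M * dist x y powr \<alpha>)"

definition mesh :: "'a::euclidean_space set set \<Rightarrow> bool" where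
  "mesh \<T> \<longleftrightarrow> finite \<T> \<and> \<T> \<noteq> {} \<and> (\<forall>T\<in>\<T>. int DIM('a) simplex T) \<and>
     (\<forall>T\<in>\<T>. \<forall>T'\<in>\<T>. (T \<inter> T') face_of T \<and> (T \<inter> T') face_of T')"

definition meshsize :: "'a::euclidean_space set set \<Rightarrow> real" where
  "meshsize \<T> = Max (diameter ` \<T>)"

definition mesh_regular :: "real \<Rightarrow> 'a::euclidean_space set set \<Rightarrow> bool" where
  "mesh_regular \<sigma> \<T> \<longleftrightarrow>
     (\<forall>T\<in>\<T>. (\<exists>c. ball c (diameter T / \<sigma>) \<subseteq> T) \<and> meshsize \<T> \<le> \<sigma> * diameter T)"

definition mesh_domain :: "'a::euclidean_space set set \<Rightarrow> 'a set" where
  "mesh_domain \<T> = interior (\<Union>\<T>)"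

definition mesh_nodes :: "'a::euclidean_space set set \<Rightarrow> 'a set" where
  "mesh_nodes \<T> = {z. \<exists>T\<in>\<T>. z extreme_point_of T}"

text \<open>V_h: continuous piecewise linear functions (affine on each closed simplex; continuity
  on the union follows from this since the simplices are closed and finitely many).\<close>
definition Vh :: "'a::euclidean_space set set \<Rightarrow> ('a \<Rightarrow> real) set" where
  "Vh \<T> = {w. continuous_on (\<Union>\<T>) w \<and> (\<forall>T\<in>\<T>. \<exists>a b. \<forall>x\<in>T. w x = a \<bullet> x + b)}"

definition direction_set :: "real \<Rightarrow> 'a::euclidean_space set \<Rightarrow> bool" where
  "direction_set \<theta> S \<longleftrightarrow> finite S \<and> S \<subseteq> sphere 0 1 \<and> (\<forall>v\<in>S. - v \<in> S) \<and>
     (\<forall>v. norm v = 1 \<longrightarrow> (\<exists>w\<in>S. norm (v - w) \<le> \<theta>))"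

definition stencil :: "real \<Rightarrow> 'a::euclidean_space set \<Rightarrow> 'a \<Rightarrow> 'a set" where
  "stencil \<epsilon> S z = insert z ((\<lambda>v. z + \<epsilon> *\<^sub>R v) ` S)"

text \<open>minus the discrete infinity Laplacian, applied to w in V_h (for which I_h w = w).\<close>
definition neg_disc_inf_lap :: "real \<Rightarrow> 'a::euclidean_space set \<Rightarrow> ('a \<Rightarrow> real) \<Rightarrow> 'a \<Rightarrow> real" where
  "neg_disc_inf_lap \<epsilon> S w z =
     (2 * w z - Max (w ` stencil \<epsilon> S z) - Min (w ` stencil \<epsilon> S z)) / \<epsilon>\<^sup>2"

definition discrete_obstacle_solution ::
  "'a::euclidean_space set \<Rightarrow> 'a set set \<Rightarrow> real \<Rightarrow> 'a set \<Rightarrow> ('a \<Rightarrow> real) \<Rightarrow> ('a \<Rightarrow> real)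
    \<Rightarrow> ('a \<Rightarrow> real) \<Rightarrow> ('a \<Rightarrow> real) \<Rightarrow> bool" where
  "discrete_obstacle_solution \<Omega> \<T> \<epsilon> S f \<psi> gt uh \<longleftrightarrow>
     uh \<in> Vh \<T> \<and>
     (\<forall>z \<in> mesh_nodes \<T> \<inter> inner_region \<Omega> (2 * \<epsilon>).
        min (neg_disc_inf_lap \<epsilon> S uh z - f z) (uh z - \<psi> z) = 0) \<and>
     (\<forall>z \<in> mesh_nodes \<T> - inner_region \<Omega> (2 * \<epsilon>). uh z = gt z)"

definition C2_with :: "('a::euclidean_space \<Rightarrow> real) \<Rightarrow> ('a \<Rightarrow> 'a) \<Rightarrow> ('a \<Rightarrow> 'a \<Rightarrow> 'a) \<Rightarrow> bool" where
  "C2_with \<phi> G H \<longleftrightarrow>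
     (\<forall>x. (\<phi> has_derivative (\<lambda>v. G x \<bullet> v)) (at x)) \<and> continuous_on UNIV G \<and>
     (\<forall>x. (G has_derivative H x) (at x)) \<and> (\<forall>v. continuous_on UNIV (\<lambda>x. H x v))"

definition eigenvalues :: "('a::real_vector \<Rightarrow> 'a) \<Rightarrow> real set" where
  "eigenvalues L = {c. \<exists>v. v \<noteq> 0 \<and> L v = c *\<^sub>R v}"

definition inf_lap_plus :: "'a::euclidean_space \<Rightarrow> ('a \<Rightarrow> 'a) \<Rightarrow> real" where
  "inf_lap_plus p L = (if p \<noteq> 0 then (p \<bullet> L p) / (norm p)\<^sup>2 else Max (eigenvalues L))"

definition inf_lap_minus :: "'a::euclidean_space \<Rightarrow> ('a \<Rightarrow> 'a) \<Rightarrow> real" where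
  "inf_lap_minus p L = (if p \<noteq> 0 then (p \<bullet> L p) / (norm p)\<^sup>2 else Min (eigenvalues L))"

definition viscosity_obstacle_solution ::
  "'a::euclidean_space set \<Rightarrow> ('a \<Rightarrow> real) \<Rightarrow> ('a \<Rightarrow> real) \<Rightarrow> ('a \<Rightarrow> real) \<Rightarrow> ('a \<Rightarrow> real) \<Rightarrow> bool" where
  "viscosity_obstacle_solution \<Omega> f \<psi> g u \<longleftrightarrow>
     continuous_on (closure \<Omega>) u \<and> (\<forall>x\<in>frontier \<Omega>. u x = g x) \<and>
     (\<forall>x0\<in>\<Omega>. \<forall>\<phi> G H. C2_with \<phi> G H \<longrightarrow>
        ((\<exists>r>0. \<forall>x\<in>\<Omega> \<inter> ball x0 r. u x - \<phi> x \<le> u x0 - \<phi> x0) \<longrightarrow>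
            min (- inf_lap_plus (G x0) (H x0) - f x0) (u x0 - \<psi> x0) \<le> 0) \<and>
        ((\<exists>r>0. \<forall>x\<in>\<Omega> \<inter> ball x0 r. u x - \<phi> x \<ge> u x0 - \<phi> x0) \<longrightarrow>
            min (- inf_lap_minus (G x0) (H x0) - f x0) (u x0 - \<psi> x0) \<ge> 0))"

end

(* With u^eps(x) the maximum of u over the ball of radius eps around x, comparison with quadratic
   cones gives 2 u^eps(z) - u(z) - u^(2 eps)(z) <= eps^2 sup f for every viscosity subsolution u.
   Up to the Hoelder modulus at scale h + eps theta, the left-hand side bounds the discrete operator of
   u^eps from above, so u^eps is a discrete subsolution up to an error E of the size of the right-hand
   side of the estimate. As f is bounded away from zero, multiplying u^eps by 1 - c E or 1 + c E,
   according to the sign of f, makes it a strict subsolution, and the discrete maximum principle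
   compares it with the discrete solution away from the boundary and the contact set. The reverse
   estimate is the same argument for -u. *)
theory Submission
  imports Defs
begin

lemma C2_with_radial:
  fixes x :: "'a::euclidean_space" and p p' p'' :: "real \<Rightarrow> real"
  assumes p: "\<And>s. (p has_real_derivative p' s) (at s)"
    and p': "\<And>s. (p' has_real_derivative p'' s) (at s)"
    and p'': "continuous_on UNIV p''"
  shows "C2_with (\<lambda>w. p ((w - x) \<bullet> (w - x)))
    (\<lambda>w. (2 * p' ((w - x) \<bullet> (w - x))) *\<^sub>R (w - x))
    (\<lambda>w v. (2 * p' ((w - x) \<bullet> (w - x))) *\<^sub>R v
       + (4 * p'' ((w - x) \<bullet> (w - x)) * ((w - x) \<bullet> v)) *\<^sub>R (w - x))"
proof -
  have sq: "((\<lambda>w. (w - x) \<bullet> (w - x)) has_derivative (\<lambda>v. 2 * ((w - x) \<bullet> v))) (at w)" for w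
    by (auto intro!: derivative_eq_intros simp: inner_commute)
  have q: "((\<lambda>w. q ((w - x) \<bullet> (w - x))) has_derivative
      (\<lambda>v. q' ((w - x) \<bullet> (w - x)) * (2 * ((w - x) \<bullet> v)))) (at w)"
    if "\<And>s. (q has_real_derivative q' s) (at s)" for q q' :: "real \<Rightarrow> real" and w
    using has_derivative_compose[OF sq that[unfolded has_field_derivative_def]] by (simp add: mult_ac)
  have cq: "continuous_on UNIV (\<lambda>w. q ((w - x) \<bullet> (w - x)))" if "continuous_on UNIV q"
    for q :: "real \<Rightarrow> real"
    by (rule continuous_on_compose2[OF that]) (auto intro!: continuous_intros)
  have cp': "continuous_on UNIV p'"
    by (meson DERIV_continuous_on p' has_field_derivative_at_within)
  show ?thesis
    unfolding C2_with_def
  proof (intro conjI allI)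
    fix w
    show "((\<lambda>w. p ((w - x) \<bullet> (w - x))) has_derivative
        (\<lambda>v. ((2 * p' ((w - x) \<bullet> (w - x))) *\<^sub>R (w - x)) \<bullet> v)) (at w)"
      using q[OF p, of w] by (simp add: mult_ac)
    show "((\<lambda>w. (2 * p' ((w - x) \<bullet> (w - x))) *\<^sub>R (w - x)) has_derivative
       (\<lambda>v. (2 * p' ((w - x) \<bullet> (w - x))) *\<^sub>R v
       + (4 * p'' ((w - x) \<bullet> (w - x)) * ((w - x) \<bullet> v)) *\<^sub>R (w - x))) (at w)"
      by (rule has_derivative_eq_rhs,
          rule has_derivative_scaleR[OF has_derivative_mult_right[OF q[OF p', of w], of 2]
            has_derivative_diff[OF has_derivative_ident has_derivative_const]])
        (simp add: fun_eq_iff)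
  qed (intro continuous_intros cq cp' p'')+
qed

text \<open>Both conditions are stable under \<open>u \<mapsto> - u\<close>, which exchanges sub- and supersolutions; a
  vanishing gradient is only needed for test functions whose Hessian is a multiple of the identity.\<close>
definition viscosity_sub :: "'a::euclidean_space set \<Rightarrow> ('a \<Rightarrow> real) \<Rightarrow> ('a \<Rightarrow> real) \<Rightarrow> bool" where
  "viscosity_sub A f u \<longleftrightarrow> (\<forall>x0\<in>A. \<forall>\<phi> G H r.
     C2_with \<phi> G H \<longrightarrow> r > 0 \<longrightarrow> (\<forall>x\<in>ball x0 r. u x - \<phi> x \<le> u x0 - \<phi> x0) \<longrightarrow>
       (G x0 \<noteq> 0 \<longrightarrow> - (G x0 \<bullet> H x0 (G x0)) / (norm (G x0))\<^sup>2 \<le> f x0) \<and>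
       (\<forall>k. G x0 = 0 \<longrightarrow> H x0 = (\<lambda>v. k *\<^sub>R v) \<longrightarrow> - k \<le> f x0))"

lemma viscosity_subD:
  assumes "viscosity_sub A f u" "x0 \<in> A" "C2_with \<phi> G H" "r > 0"
    and "\<And>x. x \<in> ball x0 r \<Longrightarrow> u x - \<phi> x \<le> u x0 - \<phi> x0"
  shows "G x0 \<noteq> 0 \<Longrightarrow> - (G x0 \<bullet> H x0 (G x0)) / (norm (G x0))\<^sup>2 \<le> f x0"
    and "G x0 = 0 \<Longrightarrow> H x0 = (\<lambda>v. k *\<^sub>R v) \<Longrightarrow> - k \<le> f x0"
  using assms unfolding viscosity_sub_def by blast+

lemma viscosity_sub_radial:
  fixes x x0 :: "'a::euclidean_space"
  assumes vs: "viscosity_sub A f u" "x0 \<in> A" "r > 0"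
    and max: "\<And>y. y \<in> ball x0 r \<Longrightarrow>
      u y - p ((y - x) \<bullet> (y - x)) \<le> u x0 - p ((x0 - x) \<bullet> (x0 - x))"
    and p: "\<And>s. (p has_real_derivative p' s) (at s)" "\<And>s. (p' has_real_derivative p'' s) (at s)"
      "continuous_on UNIV p''"
  shows "x0 \<noteq> x \<Longrightarrow> p' ((x0 - x) \<bullet> (x0 - x)) \<noteq> 0 \<Longrightarrow>
      - (2 * p' ((x0 - x) \<bullet> (x0 - x)) + 4 * p'' ((x0 - x) \<bullet> (x0 - x)) * ((x0 - x) \<bullet> (x0 - x))) \<le> f x0"
    and "x0 = x \<Longrightarrow> - (2 * p' 0) \<le> f x0"
proof -
  note * = viscosity_subD[OF vs(1,2) C2_with_radial[OF p] vs(3) max]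
  show "- (2 * p' 0) \<le> f x0" if "x0 = x"
    by (rule *(2)) (use that in auto)
  assume ne: "x0 \<noteq> x" "p' ((x0 - x) \<bullet> (x0 - x)) \<noteq> 0"
  define d s where "d = x0 - x" and "s = d \<bullet> d"
  define g where "g = 2 * p' s"
  have s: "s > 0" using ne by (simp add: s_def d_def)
  have g: "g \<noteq> 0" using ne by (simp add: g_def s_def d_def)
  have "- ((g *\<^sub>R d) \<bullet> (g *\<^sub>R (g *\<^sub>R d) + (4 * p'' s * (d \<bullet> (g *\<^sub>R d))) *\<^sub>R d)) / (norm (g *\<^sub>R d))\<^sup>2 \<le> f x0"
    using *(1) ne by (simp add: d_def s_def g_def)
  also have "(g *\<^sub>R d) \<bullet> (g *\<^sub>R (g *\<^sub>R d) + (4 * p'' s * (d \<bullet> (g *\<^sub>R d))) *\<^sub>R d)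
      = (g + 4 * p'' s * s) * (g\<^sup>2 * s)"
    by (simp add: inner_add_right algebra_simps power2_eq_square flip: s_def)
  also have "(norm (g *\<^sub>R d))\<^sup>2 = g\<^sup>2 * s"
    by (simp add: s_def power_mult_distrib power2_norm_eq_inner)
  finally have "- (g + 4 * p'' s * s) \<le> f x0"
    using s g by simp
  then show "- (2 * p' ((x0 - x) \<bullet> (x0 - x)) + 4 * p'' ((x0 - x) \<bullet> (x0 - x)) * ((x0 - x) \<bullet> (x0 - x))) \<le> f x0"
    by (simp add: d_def s_def g_def)
qed

text \<open>The third-order Taylor polynomial of the square root at \<open>r\<^sup>2\<close>, evaluated at \<open>t\<^sup>2\<close>; it turns
  a cone into a globally smooth test function.\<close>
lemma le_cubic_sqrt:
  fixes r t :: real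
  assumes "r > 0" "t \<ge> 0"
  shows "t \<le> r + (t\<^sup>2 - r\<^sup>2) / (2 * r) - (t\<^sup>2 - r\<^sup>2)\<^sup>2 / (8 * r ^ 3) + (t\<^sup>2 - r\<^sup>2) ^ 3 / (16 * r ^ 5)"
proof -
  have "r + (t\<^sup>2 - r\<^sup>2) / (2 * r) - (t\<^sup>2 - r\<^sup>2)\<^sup>2 / (8 * r ^ 3) + (t\<^sup>2 - r\<^sup>2) ^ 3 / (16 * r ^ 5) - t
      = (t - r) ^ 4 * (t\<^sup>2 + 4 * r * t + 5 * r\<^sup>2) / (16 * r ^ 5)"
    using assms(1) by (simp add: field_simps) (simp add: power2_eq_square power3_eq_cube power4_eq_xxxx eval_nat_numeral algebra_simps)
  also have "\<dots> \<ge> 0"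
    using assms by (intro divide_nonneg_pos mult_nonneg_nonneg add_nonneg_nonneg) auto
  finally show ?thesis by simp
qed

lemma continuous_attains_sup_cball:
  fixes f :: "'a::euclidean_space \<Rightarrow> real"
  assumes "continuous_on (cball x r) f" "r \<ge> 0"
  obtains w where "w \<in> cball x r" "\<And>y. y \<in> cball x r \<Longrightarrow> f y \<le> f w"
  using continuous_attains_sup[OF compact_cball _ assms(1)] assms(2) that by auto

lemma comparison_with_quadratic_cones_strict:
  fixes x :: "'a::euclidean_space"
  assumes vs: "viscosity_sub (ball x (2 * \<epsilon>)) f u" and \<epsilon>: "\<epsilon> > 0"
    and cont: "continuous_on (cball x (2 * \<epsilon>)) u"
    and f: "\<And>y. y \<in> ball x (2 * \<epsilon>) \<Longrightarrow> f y < c"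
    and B: "\<And>y. y \<in> cball x (2 * \<epsilon>) \<Longrightarrow> u y \<le> B"
    and y: "y \<in> cball x \<epsilon>"
  shows "2 * u y \<le> u x + B + \<epsilon>\<^sup>2 * c"
proof -
  have touch: False
    if w: "w \<in> ball x (2 * \<epsilon>)" and max: "\<And>y. y \<in> cball x (2 * \<epsilon>) \<Longrightarrow> u y - p ((y - x) \<bullet> (y - x)) \<le> u w - p ((w - x) \<bullet> (w - x))"
      and p: "\<And>s. (p has_real_derivative p' s) (at s)" "\<And>s. (p' has_real_derivative p'' s) (at s)"
      "continuous_on UNIV p''"
      and c: "w \<noteq> x \<Longrightarrow> p' ((w - x) \<bullet> (w - x)) \<noteq> 0 \<and> 2 * p' ((w - x) \<bullet> (w - x)) + 4 * p'' ((w - x) \<bullet> (w - x)) * ((w - x) \<bullet> (w - x)) = - c"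
        "w = x \<Longrightarrow> 2 * p' 0 = - c" for w p p' p''
  proof -
    obtain r where r: "r > 0" "ball w r \<subseteq> ball x (2 * \<epsilon>)"
      using w by (metis open_ball open_contains_ball)
    have max': "u y - p ((y - x) \<bullet> (y - x)) \<le> u w - p ((w - x) \<bullet> (w - x))" if "y \<in> ball w r" for y
      using max that r(2) ball_subset_cball by blast
    note * = viscosity_sub_radial[OF vs w r(1) max' p]
    show False using * c f[OF w] by (cases "w = x") force+
  qed
  define b where "b = (B - u x) / (2 * \<epsilon>) + c * \<epsilon>"
  have ux: "u x \<le> B" using B[of x] \<epsilon> by simp
  have b2: "2 * \<epsilon> * b = B - u x + 2 * c * \<epsilon>\<^sup>2"
    using \<epsilon> by (simp add: b_def field_simps power2_eq_square)
  have b1: "b \<ge> c * \<epsilon>" using ux \<epsilon> by (simp add: b_def)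
  have b0: "b \<ge> 0"
  proof (cases "c \<ge> 0")
    case True
    then show ?thesis using b1 \<epsilon> by (meson mult_nonneg_nonneg less_imp_le order_trans)
  next
    case False
    have "continuous_on (cball x (2 * \<epsilon>)) (\<lambda>y. u y - (- c / 2 * ((y - x) \<bullet> (y - x))))"
      by (intro continuous_intros cont)
    then obtain w where w: "w \<in> cball x (2 * \<epsilon>)"
      and max: "\<And>y. y \<in> cball x (2 * \<epsilon>) \<Longrightarrow> u y - (- c / 2 * ((y - x) \<bullet> (y - x))) \<le> u w - (- c / 2 * ((w - x) \<bullet> (w - x)))"
      using \<epsilon> by (elim continuous_attains_sup_cball) auto
    have "w \<notin> ball x (2 * \<epsilon>)"
    proof
      assume "w \<in> ball x (2 * \<epsilon>)"
      then show False
        by (rule touch[where p = "\<lambda>s. - c / 2 * s" and p' = "\<lambda>s. - c / 2" and p'' = "\<lambda>s. 0", OF _ max])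
          (use False in \<open>auto intro!: derivative_eq_intros\<close>)
    qed
    then have "(w - x) \<bullet> (w - x) = (2 * \<epsilon>)\<^sup>2"
      using w by (simp add: dist_norm norm_minus_commute flip: power2_norm_eq_inner)
    then have "u x \<le> u w + 2 * c * \<epsilon>\<^sup>2" using max[of x] \<epsilon> by (simp add: power2_eq_square mult_ac)
    then have "2 * \<epsilon> * b \<ge> 0" using B[OF w] b2 by linarith
    then show ?thesis using \<epsilon> by (simp add: zero_le_mult_iff)
  qed
  define q where "q w = u x + b * norm (w - x) - c / 2 * (norm (w - x))\<^sup>2" for w
  have uq: "u y \<le> q y" if "y \<in> cball x (2 * \<epsilon>)" for y
  proof (rule ccontr)
    assume neg: "\<not> ?thesis"
    have "continuous_on (cball x (2 * \<epsilon>)) (\<lambda>y. u y - q y)"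
      unfolding q_def by (intro continuous_intros cont)
    then obtain w where w: "w \<in> cball x (2 * \<epsilon>)"
      and max: "\<And>y. y \<in> cball x (2 * \<epsilon>) \<Longrightarrow> u y - q y \<le> u w - q w"
      using \<epsilon> by (elim continuous_attains_sup_cball) auto
    define r where "r = norm (w - x)"
    have pos: "u w > q w" using max[OF that] neg by simp
    have "w \<noteq> x" using pos by (auto simp: q_def)
    then have r: "r > 0" by (simp add: r_def)
    have rr: "r\<^sup>2 = (w - x) \<bullet> (w - x)" by (simp add: r_def power2_norm_eq_inner)
    have r2: "r \<le> 2 * \<epsilon>" using w by (simp add: r_def dist_norm norm_minus_commute)
    have qB: "q w = B + (2 * \<epsilon> - r) * (c / 2 * (2 * \<epsilon> + r) - b)"
    proof -
      have "q w = u x + b * r - c / 2 * r\<^sup>2" by (simp add: q_def r_def)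
      moreover have "(2 * \<epsilon> - r) * (c / 2 * (2 * \<epsilon> + r) - b) = 2 * c * \<epsilon>\<^sup>2 - c / 2 * r\<^sup>2 - 2 * \<epsilon> * b + b * r"
        by (simp add: field_simps power2_eq_square)
      ultimately show ?thesis using b2 by simp
    qed
    have "(2 * \<epsilon> - r) * (c / 2 * (2 * \<epsilon> + r) - b) < 0"
      using qB pos B[OF w] by linarith
    then have r2: "r < 2 * \<epsilon>" and bb: "c / 2 * (2 * \<epsilon> + r) < b"
      using r2 by (auto simp: mult_less_0_iff)
    have grad: "b - c * r > 0"
    proof (cases "c > 0")
      case True
      then have "c * r < c / 2 * (2 * \<epsilon> + r)" using mult_strict_left_mono[of "2 * r" "2 * \<epsilon> + r" "c / 2"] r2 by simp
      then show ?thesis using bb by simp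
    next
      case False
      then consider "c = 0" | "c * r < 0" using r by (fastforce simp: mult_less_0_iff)
      then show ?thesis using bb b0 by cases auto
    qed
    define p where "p s = u x + b * (r + (s - r\<^sup>2) / (2 * r) - (s - r\<^sup>2)\<^sup>2 / (8 * r ^ 3) + (s - r\<^sup>2) ^ 3 / (16 * r ^ 5)) - c / 2 * s" for s
    define p' where "p' s = b * (1 / (2 * r) - (s - r\<^sup>2) / (4 * r ^ 3) + 3 * (s - r\<^sup>2)\<^sup>2 / (16 * r ^ 5)) - c / 2" for s
    define p'' where "p'' s = b * (- 1 / (4 * r ^ 3) + 6 * (s - r\<^sup>2) / (16 * r ^ 5))" for s
    have pq: "q y \<le> p ((y - x) \<bullet> (y - x))" for y
      using mult_left_mono[OF le_cubic_sqrt[OF r norm_ge_zero] b0, of "y - x"]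
      by (simp add: q_def p_def flip: power2_norm_eq_inner)
    have pqw: "q w = p ((w - x) \<bullet> (w - x))"
      unfolding q_def p_def rr[symmetric] by (simp add: r_def)
    have "w \<in> ball x (2 * \<epsilon>)" using r2 by (simp add: r_def dist_norm norm_minus_commute)
    then show False
    proof (rule touch[of w p p' p''])
      show "u y - p ((y - x) \<bullet> (y - x)) \<le> u w - p ((w - x) \<bullet> (w - x))" if "y \<in> cball x (2 * \<epsilon>)" for y
        using max[OF that] pq[of y] pqw by linarith
      show "(p has_real_derivative p' s) (at s)" "(p' has_real_derivative p'' s) (at s)" for s
        unfolding p_def p'_def p''_def using r by (auto intro!: derivative_eq_intros simp: field_simps)
      show "continuous_on UNIV p''" unfolding p''_def using r by (intro continuous_intros) auto
      have p'r: "2 * p' (r\<^sup>2) * r = b - c * r" and p''r: "2 * p' (r\<^sup>2) + 4 * p'' (r\<^sup>2) * r\<^sup>2 = - c"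
        using r by (simp_all add: p'_def p''_def field_simps power2_eq_square power3_eq_cube)
      have "p' (r\<^sup>2) \<noteq> 0" using p'r grad by auto
      then show "p' ((w - x) \<bullet> (w - x)) \<noteq> 0 \<and> 2 * p' ((w - x) \<bullet> (w - x)) + 4 * p'' ((w - x) \<bullet> (w - x)) * ((w - x) \<bullet> (w - x)) = - c"
        using p''r by (simp add: rr)
    qed (use \<open>w \<noteq> x\<close> in auto)
  qed
  define r where "r = norm (y - x)"
  have r: "0 \<le> r" "r \<le> \<epsilon>" using y by (auto simp: r_def dist_norm norm_minus_commute)
  have "b \<ge> c / 2 * (\<epsilon> + r)"
  proof (cases "c \<ge> 0")
    case True
    then have "c / 2 * (\<epsilon> + r) \<le> c * \<epsilon>" using mult_left_mono[OF r(2) True] by (simp add: algebra_simps)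
    then show ?thesis using b1 by simp
  next
    case False
    then have "c / 2 * (\<epsilon> + r) \<le> 0" using r \<epsilon> by (intro mult_nonpos_nonneg) auto
    then show ?thesis using b0 by simp
  qed
  then have "0 \<le> (\<epsilon> - r) * (b - c / 2 * (\<epsilon> + r))" using r by simp
  moreover have "q y = u x + \<epsilon> * b - c / 2 * \<epsilon>\<^sup>2 - (\<epsilon> - r) * (b - c / 2 * (\<epsilon> + r))"
    by (simp add: q_def r_def[symmetric] field_simps power2_eq_square)
  moreover have "u y \<le> q y" using y \<epsilon> by (intro uq) auto
  ultimately have "2 * u y \<le> 2 * u x + 2 * \<epsilon> * b - c * \<epsilon>\<^sup>2" by simp
  then show ?thesis unfolding b2 by (simp add: algebra_simps)
qed

lemma comparison_with_quadratic_cones: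
  fixes x :: "'a::euclidean_space"
  assumes "viscosity_sub (ball x (2 * \<epsilon>)) f u" and \<epsilon>: "\<epsilon> > 0"
    and "continuous_on (cball x (2 * \<epsilon>)) u"
    and f: "\<And>y. y \<in> ball x (2 * \<epsilon>) \<Longrightarrow> f y \<le> c"
    and "\<And>y. y \<in> cball x (2 * \<epsilon>) \<Longrightarrow> u y \<le> B"
    and "y \<in> cball x \<epsilon>"
  shows "2 * u y \<le> u x + B + \<epsilon>\<^sup>2 * c"
proof (rule field_le_epsilon)
  fix e :: real assume "e > 0"
  have "2 * u y \<le> u x + B + \<epsilon>\<^sup>2 * (c + e / \<epsilon>\<^sup>2)"
  proof (rule comparison_with_quadratic_cones_strict[OF assms(1-3)])
    show "f y < c + e / \<epsilon>\<^sup>2" if "y \<in> ball x (2 * \<epsilon>)" for y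
      using f[OF that] \<open>e > 0\<close> \<epsilon> by (smt (verit) divide_pos_pos zero_less_power)
  qed (use assms in auto)
  then show "2 * u y \<le> u x + B + \<epsilon>\<^sup>2 * c + e" using \<epsilon> by (simp add: algebra_simps)
qed

lemma affine_on_compact_convex_ge:
  fixes T :: "'a::euclidean_space set"
  assumes T: "compact T" "convex T" and w: "\<And>y. y \<in> T \<Longrightarrow> w y = a \<bullet> y + b"
    and ge: "\<And>p. p extreme_point_of T \<Longrightarrow> k \<le> w p" and x: "x \<in> T"
  shows "k \<le> w x"
proof -
  have "{p. p extreme_point_of T} \<subseteq> {y. a \<bullet> y \<ge> k - b}"
    using ge w by (fastforce simp: extreme_point_of_def)
  then have "convex hull {p. p extreme_point_of T} \<subseteq> {y. a \<bullet> y \<ge> k - b}"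
    by (intro hull_minimal convex_halfspace_ge)
  then show ?thesis
    using Krein_Milman_Minkowski[OF T] x w[OF x] by auto
qed

lemma Vh_ge:
  assumes "mesh \<T>" "w \<in> Vh \<T>" "T \<in> \<T>" "x \<in> T"
    and "\<And>p. p extreme_point_of T \<Longrightarrow> k \<le> w p"
  shows "k \<le> w x"
proof -
  have T: "compact T" "convex T"
    using assms(1,3) by (auto simp: mesh_def intro: compact_simplex convex_simplex)
  obtain a b where "\<And>y. y \<in> T \<Longrightarrow> w y = a \<bullet> y + b"
    using assms(2,3) by (auto simp: Vh_def)
  then show ?thesis using affine_on_compact_convex_ge[OF T] assms(4,5) by blast
qed

lemma Vh_uminus:
  assumes "w \<in> Vh \<T>" shows "(\<lambda>x. - w x) \<in> Vh \<T>"
proof -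
  have "\<exists>a b. \<forall>x\<in>T. - w x = a \<bullet> x + b" if "T \<in> \<T>" for T
  proof -
    have "\<exists>a b. \<forall>x\<in>T. w x = a \<bullet> x + b" using assms that unfolding Vh_def by blast
    then obtain a b where "\<forall>x\<in>T. w x = a \<bullet> x + b" by blast
    then show ?thesis by (intro exI[of _ "- a"] exI[of _ "- b"]) auto
  qed
  then show ?thesis using assms by (auto simp: Vh_def intro: continuous_on_minus)
qed

lemma dist_le_meshsize:
  assumes "mesh (\<T> :: 'a::euclidean_space set set)" "T \<in> \<T>" "x \<in> T" "y \<in> T"
  shows "dist x y \<le> meshsize \<T>"
proof -
  have "int DIM('a) simplex T" using assms(1,2) by (auto simp: mesh_def)
  then have "bounded T" by (intro compact_imp_bounded compact_simplex)
  then have "dist x y \<le> diameter T" using assms diameter_bounded_bound by blast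
  also have "\<dots> \<le> meshsize \<T>" using assms by (auto simp: mesh_def meshsize_def)
  finally show ?thesis .
qed

lemma finite_mesh_nodes:
  assumes "mesh \<T>" shows "finite (mesh_nodes \<T>)"
proof -
  have "mesh_nodes \<T> = (\<Union>T\<in>\<T>. {z. z extreme_point_of T})" by (auto simp: mesh_nodes_def)
  then show ?thesis
    using assms by (auto simp: mesh_def intro!: finite_polyhedron_extreme_points simplex_imp_polyhedron)
qed

lemma extreme_point_in_mesh_nodes: "T \<in> \<T> \<Longrightarrow> p extreme_point_of T \<Longrightarrow> p \<in> mesh_nodes \<T>"
  by (auto simp: mesh_nodes_def)

lemma mesh_nodes_nonempty:
  assumes "mesh \<T>" shows "mesh_nodes \<T> \<noteq> {}"
proof -
  obtain T where T: "T \<in> \<T>" "int DIM('a) simplex T" using assms by (auto simp: mesh_def)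
  then have "T \<noteq> {}" by auto
  then have "{x. x extreme_point_of T} \<noteq> {}"
    using Krein_Milman_Minkowski[OF compact_simplex convex_simplex, OF T(2) T(2)] by auto
  then show ?thesis using T by (auto simp: mesh_nodes_def)
qed

lemma interior_full_simplex_nonempty:
  fixes T :: "'a::euclidean_space set"
  assumes "int DIM('a) simplex T" shows "interior T \<noteq> {}"
proof
  assume i: "interior T = {}"
  have "T \<noteq> {}" using assms by auto
  then have "rel_interior T \<noteq> {}" using rel_interior_eq_empty convex_simplex[OF assms] by blast
  moreover have "affine hull T = UNIV"
    using aff_dim_simplex[OF assms] aff_dim_eq_full by blast
  then have "rel_interior T = interior T" by (rule rel_interior_interior)
  ultimately show False using i by simp
qed

lemma meshsize_pos:
  assumes "mesh (\<T> :: 'a::euclidean_space set set)" shows "meshsize \<T> > 0"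
proof -
  obtain T where T: "T \<in> \<T>" "int DIM('a) simplex T" using assms by (auto simp: mesh_def)
  obtain c r where "r > 0" "cball c r \<subseteq> T"
    using interior_full_simplex_nonempty[OF T(2)] by (meson mem_interior_cball ex_in_conv)
  moreover obtain y where "dist c y = r" using \<open>r > 0\<close> vector_choose_dist[of r c] by auto
  ultimately have "dist c y \<le> meshsize \<T>"
    by (intro dist_le_meshsize[OF assms T(1)]) auto
  then show ?thesis using \<open>r > 0\<close> \<open>dist c y = r\<close> by simp
qed

lemma Union_mesh_subset_closure:
  assumes "mesh (\<T> :: 'a::euclidean_space set set)"
  shows "\<Union>\<T> \<subseteq> closure (mesh_domain \<T>)"
proof (rule Union_least)
  fix T assume T: "T \<in> \<T>"
  then have s: "int DIM('a) simplex T" using assms by (auto simp: mesh_def)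
  have "T \<subseteq> closure (interior T)"
    using convex_closure_interior[OF convex_simplex[OF s] interior_full_simplex_nonempty[OF s]]
    by (simp add: closure_subset)
  also have "\<dots> \<subseteq> closure (mesh_domain \<T>)"
    unfolding mesh_domain_def using T by (intro closure_mono interior_mono) auto
  finally show "T \<subseteq> closure (mesh_domain \<T>)" .
qed

lemma mesh_nodes_subset:
  assumes "mesh \<T>" "mesh_domain \<T> \<subseteq> \<Omega>"
  shows "mesh_nodes \<T> \<subseteq> closure \<Omega>"
  using Union_mesh_subset_closure[OF assms(1)] closure_mono[OF assms(2)]
  unfolding mesh_nodes_def extreme_point_of_def by blast

lemma cball_subset_of_inner_region:
  assumes z: "z \<in> inner_region \<Omega> r" and r: "r \<ge> 0"
  shows "cball z r \<subseteq> \<Omega>"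
proof (rule ccontr)
  assume "\<not> ?thesis"
  moreover have "z \<in> cball z r \<inter> \<Omega>" using z r by (auto simp: inner_region_def)
  ultimately obtain y where "y \<in> cball z r" "y \<in> frontier \<Omega>"
    using connected_Int_frontier[of "cball z r" \<Omega>] connected_cball by blast
  then have "infdist z (frontier \<Omega>) \<le> r" using infdist_le2[of y "frontier \<Omega>" z r] by auto
  then show False using z by (auto simp: inner_region_def)
qed

lemma inner_region_shift:
  assumes z: "z \<in> inner_region \<Omega> (r + s)" and "r \<ge> 0" "s \<ge> 0" "dist z x \<le> s"
  shows "x \<in> inner_region \<Omega> r"
proof -
  have "x \<in> \<Omega>" using cball_subset_of_inner_region[OF z] assms by auto
  moreover have "infdist z (frontier \<Omega>) \<le> infdist x (frontier \<Omega>) + dist z x" by (rule infdist_triangle)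
  ultimately show ?thesis using assms by (auto simp: inner_region_def)
qed

lemma frontier_near_outside_inner_region:
  fixes \<Omega> :: "'a::euclidean_space set"
  assumes "bounded \<Omega>" "open \<Omega>" "\<Omega> \<noteq> {}" "z \<in> closure \<Omega>" "z \<notin> inner_region \<Omega> r" "r \<ge> 0"
  obtains y where "y \<in> frontier \<Omega>" "dist z y \<le> r"
proof (cases "z \<in> \<Omega>")
  case True
  have "frontier \<Omega> \<noteq> {}"
    using assms(1,3) by (intro frontier_not_empty) auto
  then obtain y where "y \<in> frontier \<Omega>" "infdist z (frontier \<Omega>) = dist z y"
    using infdist_attains_inf[OF frontier_closed] by blast
  then show ?thesis using that True assms(5) by (auto simp: inner_region_def)
next
  case False
  then have "z \<in> frontier \<Omega>" using assms(2,4) by (simp add: frontier_def interior_open)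
  then show ?thesis using that assms(6) by auto
qed

lemma segment_point_near:
  fixes y p :: "'a::euclidean_space"
  assumes "dist y p \<le> r + t" "r \<ge> 0" "t \<ge> 0"
  obtains y' where "y' \<in> closed_segment y p" "dist y' p \<le> r" "dist y y' \<le> t"
proof (cases "dist y p \<le> r")
  case True
  then show ?thesis using that[of y] assms by auto
next
  case False
  define k where "k = r / dist y p"
  have d: "dist y p > 0" "norm (y - p) > 0" using False assms(2) by (auto simp: dist_norm)
  have k: "0 \<le> k" "k \<le> 1" "k * dist y p = r" using False assms(2) d by (auto simp: k_def)
  show ?thesis
  proof (rule that[of "p + k *\<^sub>R (y - p)"])
    show "p + k *\<^sub>R (y - p) \<in> closed_segment y p"
      unfolding closed_segment_def using k by (auto intro!: exI[of _ "1 - k"] simp: algebra_simps)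
    show "dist (p + k *\<^sub>R (y - p)) p \<le> r" using k by (simp add: dist_norm)
    have "y - (p + k *\<^sub>R (y - p)) = (1 - k) *\<^sub>R (y - p)" by (simp add: algebra_simps)
    then have "dist y (p + k *\<^sub>R (y - p)) = (1 - k) * dist y p" using k by (simp add: dist_norm)
    also have "\<dots> = dist y p - r" using k(3) by (simp add: algebra_simps)
    finally show "dist y (p + k *\<^sub>R (y - p)) \<le> t" using assms by simp
  qed
qed

lemma stencil_dist:
  assumes "direction_set \<theta> S" "\<epsilon> \<ge> 0" "x \<in> stencil \<epsilon> S z"
  shows "dist z x \<le> \<epsilon>"
  using assms by (auto simp: direction_set_def stencil_def dist_norm)

text \<open>Every point of the ball of radius \<open>2 * \<epsilon>\<close> is within \<open>\<epsilon>\<close> of the sphere of radius \<open>\<epsilon>\<close>, so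
  that the stencil sees the whole ball although it contains no interior direction.\<close>
lemma stencil_near:
  fixes z y :: "'a::euclidean_space"
  assumes S: "direction_set \<theta> S" and \<epsilon>: "\<epsilon> \<ge> 0" and y: "dist z y \<le> 2 * \<epsilon>"
  obtains x where "x \<in> stencil \<epsilon> S z" "dist y x \<le> \<epsilon> + \<epsilon> * \<theta>"
proof -
  obtain e where e: "norm e = 1" "y - z = norm (y - z) *\<^sub>R e"
  proof (cases "y = z")
    case True
    then show ?thesis using that vector_choose_size[of 1] by auto
  next
    case False
    then show ?thesis using that[of "sgn (y - z)"] by (simp add: norm_sgn sgn_div_norm)
  qed
  obtain v where v: "v \<in> S" "norm (e - v) \<le> \<theta>" using S e by (auto simp: direction_set_def)
  have "y - (z + \<epsilon> *\<^sub>R v) = (norm (y - z) - \<epsilon>) *\<^sub>R e + \<epsilon> *\<^sub>R (e - v)"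
    using e(2) by (simp add: algebra_simps)
  then have "dist y (z + \<epsilon> *\<^sub>R v) \<le> \<bar>norm (y - z) - \<epsilon>\<bar> + \<epsilon> * norm (e - v)"
    unfolding dist_norm using norm_triangle_ineq[of "(norm (y - z) - \<epsilon>) *\<^sub>R e" "\<epsilon> *\<^sub>R (e - v)"] e(1) \<epsilon> by simp
  also have "\<dots> \<le> \<epsilon> + \<epsilon> * \<theta>"
    using y \<epsilon> v(2) norm_ge_zero[of "y - z"] by (intro add_mono mult_left_mono) (auto simp: dist_norm norm_minus_commute simp del: norm_ge_zero)
  finally show ?thesis using v that[of "z + \<epsilon> *\<^sub>R v"] by (auto simp: stencil_def)
qed

lemma holder_boundedD:
  assumes "holder_bounded A \<alpha> M u" "M \<ge> 0" "\<alpha> \<ge> 0" "x \<in> A" "y \<in> A" "dist x y \<le> t"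
  shows "\<bar>u x - u y\<bar> \<le> M * t powr \<alpha>"
proof -
  have "\<bar>u x - u y\<bar> \<le> M * dist x y powr \<alpha>" using assms by (auto simp: holder_bounded_def)
  also have "\<dots> \<le> M * t powr \<alpha>" using assms by (intro mult_left_mono powr_mono2) auto
  finally show ?thesis .
qed

lemma holder_bounded_mono: "holder_bounded A \<alpha> M u \<Longrightarrow> M \<le> M' \<Longrightarrow> holder_bounded A \<alpha> M' u"
  unfolding holder_bounded_def
  by (meson mult_right_mono order_trans powr_ge_zero)

lemma holder_bounded_uminus: "holder_bounded A \<alpha> M (\<lambda>x. - u x) \<longleftrightarrow> holder_bounded A \<alpha> M u"
  by (simp add: holder_bounded_def abs_minus_commute)

lemma powr_double_le:
  fixes t \<alpha> :: real
  assumes "t \<ge> 0" "0 \<le> \<alpha>" "\<alpha> \<le> 1"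
  shows "(2 * t) powr \<alpha> \<le> 2 * t powr \<alpha>"
proof -
  have "2 powr \<alpha> \<le> (2::real) powr 1" using assms by (intro powr_mono) auto
  then show ?thesis using assms by (simp add: powr_mult mult_right_mono)
qed

lemma powr_add_le:
  fixes s t \<alpha> :: real
  assumes "s \<ge> 0" "t \<ge> 0" "0 \<le> \<alpha>" "\<alpha> \<le> 1"
  shows "(s + t) powr \<alpha> \<le> 2 * (s powr \<alpha> + t powr \<alpha>)"
proof -
  have "(s + t) powr \<alpha> \<le> (2 * max s t) powr \<alpha>" using assms by (intro powr_mono2) auto
  also have "\<dots> \<le> 2 * max s t powr \<alpha>" using assms by (intro powr_double_le) auto
  also have "max s t powr \<alpha> \<le> s powr \<alpha> + t powr \<alpha>" by (simp add: max_def)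
  finally show ?thesis by simp
qed

definition ball_sup :: "'a::euclidean_space set \<Rightarrow> real \<Rightarrow> ('a \<Rightarrow> real) \<Rightarrow> 'a \<Rightarrow> real" where
  "ball_sup A \<epsilon> U p = Sup (U ` (cball p \<epsilon> \<inter> A))"

lemma ball_sup_ge:
  assumes "\<And>y. y \<in> A \<Longrightarrow> \<bar>U y\<bar> \<le> M" "y \<in> A" "dist y p \<le> \<epsilon>"
  shows "U y \<le> ball_sup A \<epsilon> U p"
  unfolding ball_sup_def
proof (rule cSup_upper)
  show "bdd_above (U ` (cball p \<epsilon> \<inter> A))" using assms(1) by (fastforce intro: bdd_aboveI[of _ M])
qed (use assms in \<open>auto simp: dist_commute\<close>)

lemma ball_sup_le:
  assumes "p \<in> A" "\<epsilon> \<ge> 0" "\<And>y. y \<in> A \<Longrightarrow> dist p y \<le> \<epsilon> \<Longrightarrow> U y \<le> k"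
  shows "ball_sup A \<epsilon> U p \<le> k"
proof -
  have "p \<in> cball p \<epsilon> \<inter> A" using assms by simp
  then show ?thesis
    unfolding ball_sup_def using assms(3) by (intro cSup_least) (blast, auto)
qed

lemma segment_in_cball:
  fixes p q z :: "'a::real_normed_vector"
  assumes "p \<in> cball z r" "q \<in> cball z r" "y \<in> closed_segment p q"
  shows "y \<in> cball z r"
  using assms closed_segment_subset[OF _ _ convex_cball] by blast

text \<open>\<open>ball_sup\<close> of \<open>U\<close>, scaled by a factor near one, is a strict discrete subsolution: the sign
  of \<open>F\<close> turns the scaling into a gain of order \<open>m\<close>. Applied to \<open>U = u\<close> and to \<open>U = - u\<close>; the first
  alternative of the node hypothesis absorbs both the boundary nodes and the contact set.\<close>
lemma discrete_one_sided_estimate: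
  fixes \<Omega> :: "'a::euclidean_space set" and \<alpha> M m \<epsilon> \<theta> :: real
  defines "R \<equiv> \<lambda>h::real. \<epsilon> powr \<alpha> + ((\<epsilon> * \<theta>) powr \<alpha> + h powr \<alpha>) / \<epsilon>\<^sup>2"
  assumes \<alpha>: "0 < \<alpha>" "\<alpha> \<le> 1" and M: "0 < M" and m: "0 < m"
    and mesh: "mesh \<T>" and mesh_in: "inner_region \<Omega> (meshsize \<T>) \<subseteq> mesh_domain \<T>" "mesh_domain \<T> \<subseteq> \<Omega>"
    and h\<epsilon>: "meshsize \<T> \<le> \<epsilon>" and \<theta>: "0 < \<theta>" and S: "direction_set \<theta> S"
    and U: "holder_bounded (closure \<Omega>) \<alpha> M U" and Uc: "continuous_on (closure \<Omega>) U"
    and F: "holder_bounded (closure \<Omega>) \<alpha> M F"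
    and sign: "(\<forall>x\<in>\<Omega>. F x \<ge> m) \<or> (\<forall>x\<in>\<Omega>. F x \<le> - m)"
    and Uh: "Uh \<in> Vh \<T>"
    and small: "7 * M * R (meshsize \<T>) \<le> m"
    and node: "\<And>z. z \<in> mesh_nodes \<T> \<Longrightarrow> U z \<le> Uh z + 5 * M * \<epsilon> powr \<alpha> \<or>
      (z \<in> inner_region \<Omega> (2 * \<epsilon>) \<and> F z \<le> neg_disc_inf_lap \<epsilon> S Uh z \<and> viscosity_sub (ball z (2 * \<epsilon>)) F U)"
    and x: "x \<in> mesh_domain \<T>"
  shows "U x - Uh x \<le> (7 * M + 14 * M\<^sup>2 / m) * R (meshsize \<T>)"
proof -
  define h where "h = meshsize \<T>"
  have h: "0 < h" "h \<le> \<epsilon>" using meshsize_pos[OF mesh] h\<epsilon> by (auto simp: h_def)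
  then have \<epsilon>: "\<epsilon> > 0" by simp
  define Q where "Q = (\<epsilon> * \<theta>) powr \<alpha> + h powr \<alpha>"
  define \<eta> where "\<eta> = 7 * M * R h / m"
  have Q: "Q > 0" using h unfolding Q_def by (intro add_nonneg_pos) auto
  have R: "R h = \<epsilon> powr \<alpha> + Q / \<epsilon>\<^sup>2" by (simp add: R_def Q_def)
  have \<epsilon>\<alpha>: "\<epsilon> powr \<alpha> > 0" using \<epsilon> by simp
  have Rpos: "R h > 0" "\<epsilon> powr \<alpha> \<le> R h" using Q \<epsilon> \<epsilon>\<alpha> by (auto simp: R intro: add_pos_pos)
  have \<eta>: "0 < \<eta>" "\<eta> \<le> 1" "\<eta> * m = 7 * M * R h"
    using M m Rpos small by (auto simp: \<eta>_def h_def)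
  note HU = holder_boundedD[OF U less_imp_le[OF M] less_imp_le[OF \<alpha>(1)]]
  have UM: "\<bar>U y\<bar> \<le> M" if "y \<in> closure \<Omega>" for y
    using U that by (auto simp: holder_bounded_def)
  define v where "v = ball_sup (closure \<Omega>) \<epsilon> U"
  have v_ge: "U y \<le> v p" if "y \<in> closure \<Omega>" "dist y p \<le> \<epsilon>" for y p
    unfolding v_def using UM that by (rule ball_sup_ge)
  have v_le: "v p \<le> k" if "p \<in> closure \<Omega>" "\<And>y. y \<in> closure \<Omega> \<Longrightarrow> dist p y \<le> \<epsilon> \<Longrightarrow> U y \<le> k" for p k
    unfolding v_def using that \<epsilon> by (intro ball_sup_le) auto
  have vM: "\<bar>v p\<bar> \<le> M" if p: "p \<in> closure \<Omega>" for p
  proof -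
    have "v p \<le> M" using UM by (intro v_le p) (auto simp: abs_le_iff)
    moreover have "- M \<le> v p" using v_ge[OF p, of p] UM[OF p] \<epsilon> by (auto simp: abs_le_iff)
    ultimately show ?thesis by simp
  qed
  have nodes: "mesh_nodes \<T> \<subseteq> closure \<Omega>" using mesh mesh_in(2) by (rule mesh_nodes_subset)
  obtain s where s: "0 \<le> s" "s \<le> 2" "\<bar>s - 1\<bar> \<le> \<eta>" "\<And>z. z \<in> \<Omega> \<Longrightarrow> \<eta> * m \<le> (1 - s) * F z"
  proof (cases "\<forall>x\<in>\<Omega>. F x \<ge> m")
    case True
    then have "\<eta> * m \<le> \<eta> * F z" if "z \<in> \<Omega>" for z
      using that \<eta>(1) by (intro mult_left_mono) auto
    then show ?thesis using that[of "1 - \<eta>"] \<eta>(1,2) by auto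
  next
    case False
    then have "\<eta> * m \<le> \<eta> * - F z" if "z \<in> \<Omega>" for z
      using that sign \<eta>(1) by (intro mult_left_mono) force+
    then show ?thesis using that[of "1 + \<eta>"] \<eta>(1,2) by auto
  qed
  have sv: "\<bar>s * v p - v p\<bar> \<le> \<eta> * M" if "p \<in> closure \<Omega>" for p
  proof -
    have "\<bar>s * v p - v p\<bar> = \<bar>s - 1\<bar> * \<bar>v p\<bar>" by (simp add: abs_mult[symmetric] algebra_simps)
    also have "\<dots> \<le> \<eta> * M" using s(3) vM[OF that] \<eta> by (intro mult_mono) auto
    finally show ?thesis .
  qed
  define E where "E = Max ((\<lambda>p. s * v p - Uh p) ` mesh_nodes \<T>)"
  have E_ge: "s * v p - E \<le> Uh p" if "p \<in> mesh_nodes \<T>" for p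
  proof -
    have "s * v p - Uh p \<le> E"
      unfolding E_def using finite_mesh_nodes[OF mesh] that by (intro Max_ge) auto
    then show ?thesis by simp
  qed
  have "E \<in> (\<lambda>p. s * v p - Uh p) ` mesh_nodes \<T>"
    unfolding E_def using finite_mesh_nodes[OF mesh] mesh_nodes_nonempty[OF mesh] by (intro Max_in) auto
  then obtain z where z: "z \<in> mesh_nodes \<T>" "E = s * v z - Uh z" by auto
  have zc: "z \<in> closure \<Omega>" using z nodes by auto
  have "E \<le> 6 * M * \<epsilon> powr \<alpha> + \<eta> * M"
  proof (cases "U z \<le> Uh z + 5 * M * \<epsilon> powr \<alpha>")
    case True
    have "v z \<le> U z + M * \<epsilon> powr \<alpha>"
      using HU[OF zc] by (intro v_le zc) (force simp: abs_le_iff)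
    then show ?thesis using True sv[OF zc] z(2) by (simp add: abs_le_iff)
  next
    case False
    then have zi: "z \<in> inner_region \<Omega> (2 * \<epsilon>)" and lap: "F z \<le> neg_disc_inf_lap \<epsilon> S Uh z"
      and vs: "viscosity_sub (ball z (2 * \<epsilon>)) F U" using node[OF z(1)] by auto
    have z\<Omega>: "z \<in> \<Omega>" using zi by (auto simp: inner_region_def)
    have cb: "cball z (2 * \<epsilon>) \<subseteq> \<Omega>" using zi \<epsilon> by (intro cball_subset_of_inner_region) auto
    then have cbc: "cball z (2 * \<epsilon>) \<subseteq> closure \<Omega>" using closure_subset by blast
    have Uc': "continuous_on (cball z (2 * \<epsilon>)) U" using Uc cbc continuous_on_subset by blast
    have "z \<in> cball z (2 * \<epsilon>)" using \<epsilon> by simp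
    then obtain y where y: "y \<in> cball z (2 * \<epsilon>)" and ymax: "\<And>w. w \<in> cball z (2 * \<epsilon>) \<Longrightarrow> U w \<le> U y"
      using continuous_attains_sup_cball[OF Uc'] \<epsilon> by auto
    have cone: "2 * v z \<le> U z + U y + \<epsilon>\<^sup>2 * (F z + 2 * M * \<epsilon> powr \<alpha>)"
    proof -
      have Fle: "F w \<le> F z + 2 * M * \<epsilon> powr \<alpha>" if "w \<in> ball z (2 * \<epsilon>)" for w
      proof -
        have "w \<in> closure \<Omega>" using that cbc ball_subset_cball by blast
        then have "\<bar>F z - F w\<bar> \<le> M * (2 * \<epsilon>) powr \<alpha>"
          using that by (intro holder_boundedD[OF F _ _ zc]) (use M \<alpha> in auto)
        moreover have "M * (2 * \<epsilon>) powr \<alpha> \<le> M * (2 * \<epsilon> powr \<alpha>)"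
          using powr_double_le[of \<epsilon> \<alpha>] \<epsilon> \<alpha> M by (intro mult_left_mono) auto
        ultimately show ?thesis by (simp add: abs_le_iff)
      qed
      have "v z \<le> (U z + U y + \<epsilon>\<^sup>2 * (F z + 2 * M * \<epsilon> powr \<alpha>)) / 2"
      proof (rule v_le[OF zc])
        fix w assume "dist z w \<le> \<epsilon>"
        then have "2 * U w \<le> U z + U y + \<epsilon>\<^sup>2 * (F z + 2 * M * \<epsilon> powr \<alpha>)"
          by (intro comparison_with_quadratic_cones[OF vs \<epsilon> Uc' Fle ymax]) auto
        then show "U w \<le> (U z + U y + \<epsilon>\<^sup>2 * (F z + 2 * M * \<epsilon> powr \<alpha>)) / 2" by simp
      qed
      then show ?thesis by simp
    qed
    have stencil_ge: "s * (U q - M * t powr \<alpha>) - E \<le> Uh x"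
      if x: "x \<in> stencil \<epsilon> S z" and q: "q \<in> cball z (2 * \<epsilon>)" and t: "0 \<le> t" "dist q x + h \<le> \<epsilon> + t" for x q t
    proof -
      have zx: "dist z x \<le> \<epsilon>" using stencil_dist[OF S _ x] \<epsilon> by simp
      have "x \<in> inner_region \<Omega> \<epsilon>" using inner_region_shift[of z \<Omega> \<epsilon> \<epsilon> x] zi zx \<epsilon> by simp
      then have "x \<in> mesh_domain \<T>" using mesh_in(1) h by (auto simp: inner_region_def h_def)
      then obtain T where T: "T \<in> \<T>" "x \<in> T" using interior_subset by (auto simp: mesh_domain_def)
      show ?thesis
      proof (rule Vh_ge[OF mesh Uh T])
        fix p assume p: "p extreme_point_of T"
        then have pT: "p \<in> T" by (auto simp: extreme_point_of_def)
        have pn: "p \<in> mesh_nodes \<T>" using T(1) p by (rule extreme_point_in_mesh_nodes)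
        have xp: "dist x p \<le> h" unfolding h_def using mesh T pT by (intro dist_le_meshsize)
        have "dist q p \<le> \<epsilon> + t" using t(2) xp dist_triangle[of q p x] by linarith
        then obtain y' where y': "y' \<in> closed_segment q p" "dist y' p \<le> \<epsilon>" "dist q y' \<le> t"
          using segment_point_near \<epsilon> t(1) by (metis less_imp_le)
        have "p \<in> cball z (2 * \<epsilon>)" using zx xp h dist_triangle[of z p x] by simp
        then have "y' \<in> cball z (2 * \<epsilon>)" using segment_in_cball[OF q _ y'(1)] by blast
        then have y'c: "y' \<in> closure \<Omega>" and qc: "q \<in> closure \<Omega>" using cbc q by auto
        have "U q - M * t powr \<alpha> \<le> U y'" using HU[OF qc y'c y'(3)] by (simp add: abs_le_iff)
        also have "\<dots> \<le> v p" using v_ge[OF y'c y'(2)] .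
        finally have "s * (U q - M * t powr \<alpha>) \<le> s * v p" using s(1) by (rule mult_left_mono)
        then show "s * (U q - M * t powr \<alpha>) - E \<le> Uh p" using E_ge[OF pn] by linarith
      qed
    qed
    have fin: "finite (Uh ` stencil \<epsilon> S z)" "Uh ` stencil \<epsilon> S z \<noteq> {}"
      using S by (auto simp: direction_set_def stencil_def)
    have min: "s * (U z - M * h powr \<alpha>) - E \<le> Min (Uh ` stencil \<epsilon> S z)"
      using fin h \<epsilon> stencil_dist[OF S] by (auto intro!: stencil_ge)
    obtain x where x: "x \<in> stencil \<epsilon> S z" "dist y x \<le> \<epsilon> + \<epsilon> * \<theta>"
      using stencil_near[OF S, of \<epsilon> z y] y \<epsilon> by auto
    have "s * (U y - M * (\<epsilon> * \<theta> + h) powr \<alpha>) - E \<le> Uh x"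
      using x h \<epsilon> \<theta> y by (intro stencil_ge) auto
    also have "\<dots> \<le> Max (Uh ` stencil \<epsilon> S z)" using fin x by auto
    finally have max: "s * (U y - M * (\<epsilon> * \<theta> + h) powr \<alpha>) - E \<le> Max (Uh ` stencil \<epsilon> S z)" .
    have Uhz: "Uh z = s * v z - E" using z(2) by simp
    have "\<epsilon>\<^sup>2 * F z \<le> 2 * Uh z - Max (Uh ` stencil \<epsilon> S z) - Min (Uh ` stencil \<epsilon> S z)"
      using lap \<epsilon> by (simp add: neg_disc_inf_lap_def pos_le_divide_eq mult.commute)
    also have "\<dots> \<le> 2 * (s * v z - E) - (s * (U y - M * (\<epsilon> * \<theta> + h) powr \<alpha>) - E) - (s * (U z - M * h powr \<alpha>) - E)"
      unfolding Uhz using min max by (simp add: algebra_simps)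
    also have "\<dots> = s * (2 * v z - U z - U y) + s * (M * ((\<epsilon> * \<theta> + h) powr \<alpha> + h powr \<alpha>))"
      by (simp add: algebra_simps)
    also have "\<dots> \<le> s * (\<epsilon>\<^sup>2 * (F z + 2 * M * \<epsilon> powr \<alpha>)) + s * (M * (3 * Q))"
    proof (intro add_mono mult_left_mono)
      have "(\<epsilon> * \<theta> + h) powr \<alpha> \<le> 2 * Q"
        unfolding Q_def using \<epsilon> \<theta> h \<alpha> by (intro powr_add_le) auto
      moreover have "h powr \<alpha> \<le> Q" by (simp add: Q_def)
      ultimately show "(\<epsilon> * \<theta> + h) powr \<alpha> + h powr \<alpha> \<le> 3 * Q" by simp
    qed (use cone s M in auto)
    finally have "\<epsilon>\<^sup>2 * ((1 - s) * F z) \<le> s * (2 * M * \<epsilon> powr \<alpha> * \<epsilon>\<^sup>2 + 3 * M * Q)"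
      by (simp add: algebra_simps)
    also have "\<dots> \<le> 2 * (2 * M * \<epsilon> powr \<alpha> * \<epsilon>\<^sup>2 + 3 * M * Q)"
      using s M Q \<epsilon> by (intro mult_right_mono) auto
    also have "\<dots> = \<epsilon>\<^sup>2 * (4 * M * \<epsilon> powr \<alpha> + 6 * M * (Q / \<epsilon>\<^sup>2))"
      using \<epsilon> by (simp add: field_simps)
    finally have "(1 - s) * F z \<le> 4 * M * \<epsilon> powr \<alpha> + 6 * M * (Q / \<epsilon>\<^sup>2)"
      using \<epsilon> by simp
    also have "\<dots> < 7 * M * \<epsilon> powr \<alpha> + 7 * M * (Q / \<epsilon>\<^sup>2)"
      using M Q \<epsilon> \<epsilon>\<alpha> by (intro add_strict_mono mult_strict_right_mono) auto
    also have "\<dots> = \<eta> * m" by (simp add: \<eta>(3) R algebra_simps)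
    finally have False using s(4)[OF z\<Omega>] by simp
    then show ?thesis ..
  qed
  then have node_ge: "U p - 6 * M * \<epsilon> powr \<alpha> - 2 * \<eta> * M \<le> Uh p" if "p \<in> mesh_nodes \<T>" for p
  proof -
    have pc: "p \<in> closure \<Omega>" using that nodes by auto
    show ?thesis
      using E_ge[OF that] sv[OF pc] v_ge[OF pc, of p] \<open>E \<le> _\<close> \<epsilon> by (simp add: abs_le_iff)
  qed
  obtain T where T: "T \<in> \<T>" "x \<in> T" using x interior_subset by (auto simp: mesh_domain_def)
  have xc: "x \<in> closure \<Omega>" using x mesh_in(2) closure_subset by blast
  have "U x - M * \<epsilon> powr \<alpha> - 6 * M * \<epsilon> powr \<alpha> - 2 * \<eta> * M \<le> Uh x"
  proof (rule Vh_ge[OF mesh Uh T])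
    fix p assume p: "p extreme_point_of T"
    then have pT: "p \<in> T" by (auto simp: extreme_point_of_def)
    have pn: "p \<in> mesh_nodes \<T>" using T(1) p by (rule extreme_point_in_mesh_nodes)
    have "dist x p \<le> \<epsilon>" using dist_le_meshsize[OF mesh T pT] h\<epsilon> by linarith
    then have "U x - M * \<epsilon> powr \<alpha> \<le> U p" using HU[OF xc, of p \<epsilon>] pn nodes by (auto simp: abs_le_iff)
    then show "U x - M * \<epsilon> powr \<alpha> - 6 * M * \<epsilon> powr \<alpha> - 2 * \<eta> * M \<le> Uh p"
      using node_ge[OF pn] by simp
  qed
  then have "U x - Uh x \<le> 7 * M * \<epsilon> powr \<alpha> + 2 * \<eta> * M" by simp
  also have "\<dots> \<le> 7 * M * R h + 2 * \<eta> * M" using M Rpos by simp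
  also have "\<dots> = (7 * M + 14 * M\<^sup>2 / m) * R h" using m by (simp add: \<eta>_def field_simps power2_eq_square)
  finally show ?thesis by (simp add: h_def)
qed

lemma eigenvalues_scaleR: "eigenvalues (\<lambda>v::'a::euclidean_space. k *\<^sub>R v) = {k}"
proof -
  obtain b :: 'a where "b \<in> Basis" using nonempty_Basis by blast
  then have "b \<noteq> 0" by auto
  then show ?thesis by (auto simp: eigenvalues_def)
qed

lemma eigenvalues_uminus_scaleR: "eigenvalues (\<lambda>v::'a::euclidean_space. - (k *\<^sub>R v)) = {- k}"
  using eigenvalues_scaleR[of "- k", where 'a = 'a] by simp

lemma C2_with_uminus:
  "C2_with \<phi> G H \<Longrightarrow> C2_with (\<lambda>x. - \<phi> x) (\<lambda>x. - G x) (\<lambda>x v. - H x v)"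
  unfolding C2_with_def by (auto intro!: derivative_eq_intros continuous_intros)

lemma C2_with_linear: "C2_with \<phi> G H \<Longrightarrow> linear (H x)"
  unfolding C2_with_def by (blast intro: has_derivative_linear)

lemma viscosity_obstacle_solution_above:
  assumes "viscosity_obstacle_solution \<Omega> f \<psi> g u" "x0 \<in> \<Omega>" "C2_with \<phi> G H" "r > 0"
    and "\<And>x. x \<in> ball x0 r \<Longrightarrow> u x - \<phi> x \<le> u x0 - \<phi> x0"
  shows "min (- inf_lap_plus (G x0) (H x0) - f x0) (u x0 - \<psi> x0) \<le> 0"
  using assms unfolding viscosity_obstacle_solution_def by (meson IntD2)

lemma viscosity_obstacle_solution_below:
  assumes "viscosity_obstacle_solution \<Omega> f \<psi> g u" "x0 \<in> \<Omega>" "C2_with \<phi> G H" "r > 0"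
    and "\<And>x. x \<in> ball x0 r \<Longrightarrow> u x - \<phi> x \<ge> u x0 - \<phi> x0"
  shows "min (- inf_lap_minus (G x0) (H x0) - f x0) (u x0 - \<psi> x0) \<ge> 0"
  using assms unfolding viscosity_obstacle_solution_def by (meson IntD2)

lemma viscosity_sub_off_contact:
  assumes u: "viscosity_obstacle_solution \<Omega> f \<psi> g u"
    and A: "A \<subseteq> \<Omega>" "\<And>y. y \<in> A \<Longrightarrow> u y > \<psi> y"
  shows "viscosity_sub A f u"
  unfolding viscosity_sub_def
proof (intro ballI allI impI)
  fix x0 \<phi> G H and r :: real
  assume x0: "x0 \<in> A" and *: "C2_with \<phi> G H" "r > 0" "\<forall>x\<in>ball x0 r. u x - \<phi> x \<le> u x0 - \<phi> x0"
  then have "- inf_lap_plus (G x0) (H x0) \<le> f x0"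
    using viscosity_obstacle_solution_above[OF u _ *(1,2)] A x0 by (force simp: min_le_iff_disj)
  then show "(G x0 \<noteq> 0 \<longrightarrow> - (G x0 \<bullet> H x0 (G x0)) / (norm (G x0))\<^sup>2 \<le> f x0) \<and>
       (\<forall>k. G x0 = 0 \<longrightarrow> H x0 = (\<lambda>v. k *\<^sub>R v) \<longrightarrow> - k \<le> f x0)"
    by (auto simp: inf_lap_plus_def eigenvalues_scaleR)
qed

lemma viscosity_sub_uminus:
  assumes u: "viscosity_obstacle_solution \<Omega> f \<psi> g u" and A: "A \<subseteq> \<Omega>"
  shows "viscosity_sub A (\<lambda>x. - f x) (\<lambda>x. - u x)"
  unfolding viscosity_sub_def
proof (intro ballI allI impI)
  fix x0 \<phi> G H and r :: real
  assume x0: "x0 \<in> A" and *: "C2_with \<phi> G H" "r > 0" "\<forall>x\<in>ball x0 r. - u x - \<phi> x \<le> - u x0 - \<phi> x0"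
  have "0 \<le> min (- inf_lap_minus (- G x0) (\<lambda>v. - H x0 v) - f x0) (u x0 - \<psi> x0)"
    using viscosity_obstacle_solution_below[OF u _ C2_with_uminus[OF *(1)] *(2)] *(3) A x0 by force
  then have "f x0 \<le> - inf_lap_minus (- G x0) (\<lambda>v. - H x0 v)" by simp
  then show "(G x0 \<noteq> 0 \<longrightarrow> - (G x0 \<bullet> H x0 (G x0)) / (norm (G x0))\<^sup>2 \<le> - f x0) \<and>
       (\<forall>k. G x0 = 0 \<longrightarrow> H x0 = (\<lambda>v. k *\<^sub>R v) \<longrightarrow> - k \<le> - f x0)"
    using linear_neg[OF C2_with_linear[OF *(1), of x0]]
    by (auto simp: inf_lap_minus_def eigenvalues_uminus_scaleR)
qed

text \<open>Points where a paraboloid touches \<open>u\<close> from below are dense.\<close>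
lemma viscosity_solution_ge_obstacle:
  fixes \<Omega> :: "'a::euclidean_space set"
  assumes u: "viscosity_obstacle_solution \<Omega> f \<psi> g u" and \<Omega>: "open \<Omega>"
    and c: "continuous_on \<Omega> u" "continuous_on \<Omega> \<psi>" and x: "x \<in> \<Omega>"
  shows "\<psi> x \<le> u x"
proof (rule ccontr)
  assume neg: "\<not> \<psi> x \<le> u x"
  have "open (\<Omega> \<inter> (\<lambda>y. u y - \<psi> y) -` {..<0})"
    using c \<Omega> by (intro continuous_open_preimage continuous_intros open_lessThan)
  moreover have "x \<in> \<Omega> \<inter> (\<lambda>y. u y - \<psi> y) -` {..<0}" using neg x by simp
  ultimately obtain \<rho> where \<rho>: "\<rho> > 0" "cball x \<rho> \<subseteq> \<Omega> \<inter> (\<lambda>y. u y - \<psi> y) -` {..<0}"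
    unfolding open_contains_cball by blast
  have cu: "continuous_on (cball x \<rho>) u" using c(1) \<rho> by (auto intro: continuous_on_subset)
  then obtain y0 where y0: "\<And>y. y \<in> cball x \<rho> \<Longrightarrow> - u y \<le> - u y0" "y0 \<in> cball x \<rho>"
    using continuous_attains_sup_cball[of x \<rho> "\<lambda>y. - u y"] \<rho>(1) by (auto intro: continuous_on_minus)
  define K where "K = (u x - u y0 + 1) / \<rho>\<^sup>2"
  have K: "K * \<rho>\<^sup>2 = u x - u y0 + 1" using \<rho>(1) by (simp add: K_def)
  have "continuous_on (cball x \<rho>) (\<lambda>y. - (u y + K * ((y - x) \<bullet> (y - x))))"
    by (intro continuous_intros cu)
  then obtain w where w: "w \<in> cball x \<rho>"
    "\<And>y. y \<in> cball x \<rho> \<Longrightarrow> - (u y + K * ((y - x) \<bullet> (y - x))) \<le> - (u w + K * ((w - x) \<bullet> (w - x)))"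
    using \<rho>(1) by (elim continuous_attains_sup_cball) auto
  have "dist x w \<noteq> \<rho>"
  proof
    assume "dist x w = \<rho>"
    then have "(w - x) \<bullet> (w - x) = \<rho>\<^sup>2"
      by (simp add: dist_norm norm_minus_commute flip: power2_norm_eq_inner)
    then show False using w(2)[of x] y0(1)[OF w(1)] K \<rho>(1) by simp
  qed
  then have "w \<in> ball x \<rho>" using w(1) by simp
  then obtain r where r: "r > 0" "ball w r \<subseteq> ball x \<rho>" by (metis open_ball open_contains_ball)
  have w\<Omega>: "w \<in> \<Omega>" "u w < \<psi> w" using w(1) \<rho>(2) by auto
  have C2: "C2_with (\<lambda>y. - K * ((y - x) \<bullet> (y - x))) (\<lambda>y. (2 * - K) *\<^sub>R (y - x))
      (\<lambda>y v. (2 * - K) *\<^sub>R v + (4 * 0 * ((y - x) \<bullet> v)) *\<^sub>R (y - x))"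
    by (rule C2_with_radial[of "\<lambda>s. - K * s"]) (auto intro!: derivative_eq_intros)
  have "u w - - K * ((w - x) \<bullet> (w - x)) \<le> u y - - K * ((y - x) \<bullet> (y - x))" if "y \<in> ball w r" for y
    using w(2)[of y] that r(2) ball_subset_cball by force
  from viscosity_obstacle_solution_below[OF u w\<Omega>(1) C2 r(1) this]
  have "0 \<le> u w - \<psi> w" by simp
  then show False using w\<Omega>(2) by simp
qed

lemma neg_disc_inf_lap_uminus:
  assumes "finite S"
  shows "neg_disc_inf_lap \<epsilon> S (\<lambda>x. - w x) z = - neg_disc_inf_lap \<epsilon> S w z"
proof -
  have fin: "finite (w ` stencil \<epsilon> S z)" "w ` stencil \<epsilon> S z \<noteq> {}"
    using assms by (auto simp: stencil_def)
  have "(\<lambda>x. - w x) ` stencil \<epsilon> S z = uminus ` (w ` stencil \<epsilon> S z)" by (simp add: image_image)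
  then have "Max ((\<lambda>x. - w x) ` stencil \<epsilon> S z) = - Min (w ` stencil \<epsilon> S z)"
    "Min ((\<lambda>x. - w x) ` stencil \<epsilon> S z) = - Max (w ` stencil \<epsilon> S z)"
    using fin by (simp_all add: minus_Max_eq_Min minus_Min_eq_Max)
  then show ?thesis unfolding neg_disc_inf_lap_def minus_divide_left by (simp add: algebra_simps)
qed

theorem theorem5p8:
  fixes \<Omega> :: "'a::euclidean_space set" and \<alpha> \<sigma> M m :: real
  assumes "open \<Omega>" and "connected \<Omega>" and "\<Omega> \<noteq> {}" and "bounded \<Omega>"
    and "continuous_boundary \<Omega>"
    and "0 < \<alpha>" and "\<alpha> \<le> 1" and "0 < \<sigma>" and "0 \<le> M" and "0 < m"
  shows "\<exists>C>0. \<forall>f g \<psi> u (gt :: real \<Rightarrow> 'a \<Rightarrow> real).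
    \<comment> \<open>(RHS.1), (RHS.2a) with min |f| \<ge> m, f in C^{0,alpha}\<close>
    continuous_on \<Omega> f \<and> bounded (f ` \<Omega>) \<and>
    ((\<forall>x\<in>\<Omega>. f x \<ge> m) \<or> (\<forall>x\<in>\<Omega>. f x \<le> - m)) \<and>
    holder_bounded (closure \<Omega>) \<alpha> M f \<and>
    \<comment> \<open>(BC.1), g in C^{0,alpha}\<close>
    continuous_on (frontier \<Omega>) g \<and> holder_bounded (frontier \<Omega>) \<alpha> M g \<and>
    \<comment> \<open>(BC.2)\<close>
    (\<forall>\<epsilon>>0. continuous_on (closure \<Omega>) (gt \<epsilon>) \<and> holder_bounded (closure \<Omega>) \<alpha> M (gt \<epsilon>) \<and>
       (\<forall>x\<in>frontier \<Omega>. \<bar>g x - gt \<epsilon> x\<bar> \<le> M * \<epsilon> powr \<alpha>)) \<and>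
    \<comment> \<open>(OBS.1), chi in C^{0,alpha}\<close>
    continuous_on (closure \<Omega>) \<psi> \<and> (\<forall>x\<in>frontier \<Omega>. \<psi> x < g x) \<and>
    holder_bounded (closure \<Omega>) \<alpha> M \<psi> \<and>
    \<comment> \<open>u is the viscosity solution, u in C^{0,alpha}\<close>
    viscosity_obstacle_solution \<Omega> f \<psi> g u \<and> holder_bounded (closure \<Omega>) \<alpha> M u
    \<longrightarrow>
    (\<exists>\<delta>>0. \<exists>\<kappa>>0. \<forall>\<T> \<epsilon> \<theta> S uh.
       mesh \<T> \<and> mesh_regular \<sigma> \<T> \<and>
       inner_region \<Omega> (meshsize \<T>) \<subseteq> mesh_domain \<T> \<and> mesh_domain \<T> \<subseteq> \<Omega> \<and>
       meshsize \<T> \<le> \<epsilon> \<and> \<epsilon> \<le> diameter \<Omega> \<and> 0 < \<theta> \<and> \<theta> \<le> 1 \<and>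
       direction_set \<theta> S \<and>
       discrete_obstacle_solution \<Omega> \<T> \<epsilon> S f \<psi> (gt \<epsilon>) uh \<and>
       meshsize \<T> \<le> \<delta> \<and> \<epsilon> \<le> \<delta> \<and> \<theta> \<le> \<delta> \<and>
       ((\<epsilon> * \<theta>) powr \<alpha> + meshsize \<T> powr \<alpha>) / \<epsilon>\<^sup>2 \<le> \<kappa>
       \<longrightarrow>
       (\<forall>x\<in>mesh_domain \<T>. \<bar>u x - uh x\<bar> \<le>
          C * (\<epsilon> powr \<alpha> + \<theta> powr \<alpha> / \<epsilon> powr (2 - \<alpha>) + meshsize \<T> powr \<alpha> / \<epsilon>\<^sup>2)))"
proof -
  define N where "N = M + 1"
  define C where "C = 7 * N + 14 * N\<^sup>2 / m"
  define \<kappa> where "\<kappa> = m / (14 * N)"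
  define \<delta> where "\<delta> = \<kappa> powr (1 / \<alpha>)"
  have N: "0 < N" "M \<le> N" using assms(9) by (auto simp: N_def)
  have C: "C > 0" using N assms(10) by (auto simp: C_def intro!: add_pos_pos)
  have \<kappa>: "\<kappa> > 0" "14 * N * \<kappa> = m" using N assms(10) by (auto simp: \<kappa>_def)
  have \<delta>: "\<delta> > 0" "\<delta> powr \<alpha> = \<kappa>" using \<kappa> assms(6) by (auto simp: \<delta>_def powr_powr)
  show ?thesis
  proof (rule exI[of _ C], rule conjI[OF C], intro allI impI)
    fix f g \<psi> u :: "'a \<Rightarrow> real" and gt :: "real \<Rightarrow> 'a \<Rightarrow> real"
    assume data: "continuous_on \<Omega> f \<and> bounded (f ` \<Omega>) \<and>
      ((\<forall>x\<in>\<Omega>. f x \<ge> m) \<or> (\<forall>x\<in>\<Omega>. f x \<le> - m)) \<and>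
      holder_bounded (closure \<Omega>) \<alpha> M f \<and>
      continuous_on (frontier \<Omega>) g \<and> holder_bounded (frontier \<Omega>) \<alpha> M g \<and>
      (\<forall>\<epsilon>>0. continuous_on (closure \<Omega>) (gt \<epsilon>) \<and> holder_bounded (closure \<Omega>) \<alpha> M (gt \<epsilon>) \<and>
         (\<forall>x\<in>frontier \<Omega>. \<bar>g x - gt \<epsilon> x\<bar> \<le> M * \<epsilon> powr \<alpha>)) \<and>
      continuous_on (closure \<Omega>) \<psi> \<and> (\<forall>x\<in>frontier \<Omega>. \<psi> x < g x) \<and>
      holder_bounded (closure \<Omega>) \<alpha> M \<psi> \<and>
      viscosity_obstacle_solution \<Omega> f \<psi> g u \<and> holder_bounded (closure \<Omega>) \<alpha> M u"
    then have vu: "viscosity_obstacle_solution \<Omega> f \<psi> g u"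
      and sign: "(\<forall>x\<in>\<Omega>. f x \<ge> m) \<or> (\<forall>x\<in>\<Omega>. f x \<le> - m)" by blast+
    have uc: "continuous_on (closure \<Omega>) u" and ug: "\<And>x. x \<in> frontier \<Omega> \<Longrightarrow> u x = g x"
      using vu by (auto simp: viscosity_obstacle_solution_def)
    have hu: "holder_bounded (closure \<Omega>) \<alpha> N u" and hf: "holder_bounded (closure \<Omega>) \<alpha> N f"
      and h\<psi>: "holder_bounded (closure \<Omega>) \<alpha> N \<psi>"
      and hgt: "\<And>\<epsilon>. \<epsilon> > 0 \<Longrightarrow> holder_bounded (closure \<Omega>) \<alpha> N (gt \<epsilon>)"
      using data N(2) by (blast intro: holder_bounded_mono)+
    have ggt: "\<bar>g x - gt \<epsilon> x\<bar> \<le> N * \<epsilon> powr \<alpha>" if "\<epsilon> > 0" "x \<in> frontier \<Omega>" for \<epsilon> x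
    proof -
      have "\<bar>g x - gt \<epsilon> x\<bar> \<le> M * \<epsilon> powr \<alpha>" using data that by blast
      also have "\<dots> \<le> N * \<epsilon> powr \<alpha>" using N by (intro mult_right_mono) auto
      finally show ?thesis .
    qed
    have u\<psi>: "\<psi> x \<le> u x" if "x \<in> \<Omega>" for x
    proof (rule viscosity_solution_ge_obstacle[OF vu assms(1) _ _ that])
      show "continuous_on \<Omega> u" using uc closure_subset by (rule continuous_on_subset)
      have "continuous_on (closure \<Omega>) \<psi>" using data by blast
      then show "continuous_on \<Omega> \<psi>" using closure_subset by (rule continuous_on_subset)
    qed
    show "\<exists>\<delta>>0. \<exists>\<kappa>>0. \<forall>\<T> \<epsilon> \<theta> S uh.
       mesh \<T> \<and> mesh_regular \<sigma> \<T> \<and>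
       inner_region \<Omega> (meshsize \<T>) \<subseteq> mesh_domain \<T> \<and> mesh_domain \<T> \<subseteq> \<Omega> \<and>
       meshsize \<T> \<le> \<epsilon> \<and> \<epsilon> \<le> diameter \<Omega> \<and> 0 < \<theta> \<and> \<theta> \<le> 1 \<and>
       direction_set \<theta> S \<and>
       discrete_obstacle_solution \<Omega> \<T> \<epsilon> S f \<psi> (gt \<epsilon>) uh \<and>
       meshsize \<T> \<le> \<delta> \<and> \<epsilon> \<le> \<delta> \<and> \<theta> \<le> \<delta> \<and>
       ((\<epsilon> * \<theta>) powr \<alpha> + meshsize \<T> powr \<alpha>) / \<epsilon>\<^sup>2 \<le> \<kappa>
       \<longrightarrow>
       (\<forall>x\<in>mesh_domain \<T>. \<bar>u x - uh x\<bar> \<le>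
          C * (\<epsilon> powr \<alpha> + \<theta> powr \<alpha> / \<epsilon> powr (2 - \<alpha>) + meshsize \<T> powr \<alpha> / \<epsilon>\<^sup>2))"
    proof (rule exI[of _ \<delta>], rule conjI[OF \<delta>(1)], rule exI[of _ \<kappa>], rule conjI[OF \<kappa>(1)],
        intro allI impI ballI, elim conjE)
      fix \<T> \<epsilon> \<theta> S uh and x :: 'a
      assume mesh: "mesh \<T>" and mesh_in: "inner_region \<Omega> (meshsize \<T>) \<subseteq> mesh_domain \<T>" "mesh_domain \<T> \<subseteq> \<Omega>"
        and h: "meshsize \<T> \<le> \<epsilon>" and \<theta>: "0 < \<theta>" and S: "direction_set \<theta> S"
        and duh: "discrete_obstacle_solution \<Omega> \<T> \<epsilon> S f \<psi> (gt \<epsilon>) uh"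
        and \<epsilon>\<delta>: "\<epsilon> \<le> \<delta>" and le\<kappa>: "((\<epsilon> * \<theta>) powr \<alpha> + meshsize \<T> powr \<alpha>) / \<epsilon>\<^sup>2 \<le> \<kappa>"
        and x: "x \<in> mesh_domain \<T>"
      have \<epsilon>: "\<epsilon> > 0" using h meshsize_pos[OF mesh] by simp
      have \<epsilon>2: "N * (2 * \<epsilon>) powr \<alpha> \<le> 2 * N * \<epsilon> powr \<alpha>"
        using mult_left_mono[OF powr_double_le[of \<epsilon> \<alpha>], of N] \<epsilon> N assms(6,7) by simp
      define R where "R = \<epsilon> powr \<alpha> + ((\<epsilon> * \<theta>) powr \<alpha> + meshsize \<T> powr \<alpha>) / \<epsilon>\<^sup>2"
      have "\<epsilon> powr \<alpha> \<le> \<kappa>" using powr_mono2[of \<alpha> \<epsilon> \<delta>] \<epsilon> \<epsilon>\<delta> assms(6) \<delta>(2) by simp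
      then have "R \<le> 2 * \<kappa>" using le\<kappa> by (simp add: R_def)
      then have "7 * N * R \<le> 7 * N * (2 * \<kappa>)" using N by (intro mult_left_mono) auto
      then have small: "7 * N * R \<le> m" unfolding \<kappa>(2)[symmetric] by simp
      have R: "R = \<epsilon> powr \<alpha> + \<theta> powr \<alpha> / \<epsilon> powr (2 - \<alpha>) + meshsize \<T> powr \<alpha> / \<epsilon>\<^sup>2"
        using \<epsilon> \<theta> by (simp add: R_def powr_mult powr_diff add_divide_distrib)
      have uh: "uh \<in> Vh \<T>"
        and uh_int: "\<And>z. z \<in> mesh_nodes \<T> \<Longrightarrow> z \<in> inner_region \<Omega> (2 * \<epsilon>) \<Longrightarrow>
          min (neg_disc_inf_lap \<epsilon> S uh z - f z) (uh z - \<psi> z) = 0"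
        and uh_bd: "\<And>z. z \<in> mesh_nodes \<T> \<Longrightarrow> z \<notin> inner_region \<Omega> (2 * \<epsilon>) \<Longrightarrow> uh z = gt \<epsilon> z"
        using duh by (auto simp: discrete_obstacle_solution_def)
      note H = holder_boundedD[OF _ less_imp_le[OF N(1)] less_imp_le[OF assms(6)]]
      have nodes: "mesh_nodes \<T> \<subseteq> closure \<Omega>" using mesh mesh_in(2) by (rule mesh_nodes_subset)
      have near_bd: "\<bar>u z - uh z\<bar> \<le> 5 * N * \<epsilon> powr \<alpha>"
        if z: "z \<in> mesh_nodes \<T>" "z \<notin> inner_region \<Omega> (2 * \<epsilon>)" for z
      proof -
        have zc: "z \<in> closure \<Omega>" using z nodes by auto
        obtain y where y: "y \<in> frontier \<Omega>" "dist z y \<le> 2 * \<epsilon>"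
          using frontier_near_outside_inner_region[OF assms(4,1,3) zc z(2)] \<epsilon> by auto
        then have yc: "y \<in> closure \<Omega>" by (simp add: frontier_def)
        show ?thesis
          using H[OF hu zc yc y(2)] H[OF hgt[OF \<epsilon>] zc yc y(2)] ggt[OF \<epsilon> y(1)] ug[OF y(1)] uh_bd[OF z] \<epsilon>2
          by linarith
      qed
      have near_contact: "u z \<le> uh z + 5 * N * \<epsilon> powr \<alpha>"
        if z: "z \<in> mesh_nodes \<T>" "z \<in> inner_region \<Omega> (2 * \<epsilon>)" and y: "y \<in> \<Omega>" "dist z y \<le> 2 * \<epsilon>" "u y \<le> \<psi> y" for z y
      proof -
        have zc: "z \<in> closure \<Omega>" "y \<in> closure \<Omega>" using z nodes y(1) closure_subset by auto
        have "\<psi> z \<le> uh z" using uh_int[OF z] by linarith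
        moreover have "0 \<le> N * \<epsilon> powr \<alpha>" using N by simp
        ultimately show ?thesis
          using H[OF hu zc y(2)] H[OF h\<psi> zc y(2)] y(3) \<epsilon>2 by linarith
      qed
      have "u x - uh x \<le> C * R"
        unfolding C_def R_def
      proof (rule discrete_one_sided_estimate[OF assms(6,7) N(1) assms(10) mesh mesh_in h \<theta> S hu uc hf sign uh small[unfolded R_def] _ x])
        fix z assume z: "z \<in> mesh_nodes \<T>"
        show "u z \<le> uh z + 5 * N * \<epsilon> powr \<alpha> \<or>
          z \<in> inner_region \<Omega> (2 * \<epsilon>) \<and> f z \<le> neg_disc_inf_lap \<epsilon> S uh z \<and> viscosity_sub (ball z (2 * \<epsilon>)) f u"
        proof (cases "z \<in> inner_region \<Omega> (2 * \<epsilon>)")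
          case True
          have cb: "ball z (2 * \<epsilon>) \<subseteq> \<Omega>"
            using cball_subset_of_inner_region[OF True] \<epsilon> ball_subset_cball by fastforce
          show ?thesis
          proof (cases "\<exists>y\<in>ball z (2 * \<epsilon>). u y \<le> \<psi> y")
            case c: True
            then show ?thesis using near_contact[OF z True] cb by force
          next
            case False
            then have "viscosity_sub (ball z (2 * \<epsilon>)) f u"
              by (intro viscosity_sub_off_contact[OF vu cb]) force
            moreover have "f z \<le> neg_disc_inf_lap \<epsilon> S uh z" using uh_int[OF z True] by linarith
            ultimately show ?thesis using True by blast
          qed
        next
          case False
          then show ?thesis using near_bd[OF z] by force
        qed
      qed
      moreover have "- u x - - uh x \<le> C * R"
        unfolding C_def R_def
      proof (rule discrete_one_sided_estimate[OF assms(6,7) N(1) assms(10) mesh mesh_in h \<theta> S _ _ _ _ Vh_uminus[OF uh] small[unfolded R_def] _ x])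
        show "holder_bounded (closure \<Omega>) \<alpha> N (\<lambda>x. - u x)" "holder_bounded (closure \<Omega>) \<alpha> N (\<lambda>x. - f x)"
          using hu hf by (simp_all add: holder_bounded_uminus)
        show "continuous_on (closure \<Omega>) (\<lambda>x. - u x)" using uc by (rule continuous_on_minus)
        show "(\<forall>x\<in>\<Omega>. m \<le> - f x) \<or> (\<forall>x\<in>\<Omega>. - f x \<le> - m)" using sign by force
        fix z assume z: "z \<in> mesh_nodes \<T>"
        show "- u z \<le> - uh z + 5 * N * \<epsilon> powr \<alpha> \<or>
          z \<in> inner_region \<Omega> (2 * \<epsilon>) \<and> - f z \<le> neg_disc_inf_lap \<epsilon> S (\<lambda>x. - uh x) z \<and>
          viscosity_sub (ball z (2 * \<epsilon>)) (\<lambda>x. - f x) (\<lambda>x. - u x)"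
        proof (cases "z \<in> inner_region \<Omega> (2 * \<epsilon>)")
          case True
          have cb: "ball z (2 * \<epsilon>) \<subseteq> \<Omega>"
            using cball_subset_of_inner_region[OF True] \<epsilon> ball_subset_cball by fastforce
          have "0 \<le> N * \<epsilon> powr \<alpha>" using N by simp
          moreover have "uh z = \<psi> z \<or> neg_disc_inf_lap \<epsilon> S uh z = f z" using uh_int[OF z True] by linarith
          moreover have "\<psi> z \<le> u z" using True by (intro u\<psi>) (simp add: inner_region_def)
          moreover have "finite S" using S by (simp add: direction_set_def)
          ultimately show ?thesis
            using True viscosity_sub_uminus[OF vu cb] by (auto simp: neg_disc_inf_lap_uminus)
        next
          case False
          then show ?thesis using near_bd[OF z] by force
        qed
      qed
      ultimately show "\<bar>u x - uh x\<bar> \<le> C * (\<epsilon> powr \<alpha> + \<theta> powr \<alpha> / \<epsilon> powr (2 - \<alpha>) + meshsize \<T> powr \<alpha> / \<epsilon>\<^sup>2)"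
        unfolding R by simp
    qed
  qed
qed

end
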